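(* Let $\mu>0$ and let $F$ be a differentiable strongly exponentially general convex function on the general convex set $K_g$ (with some positive constant). If the differential $F'$ of $F$ satisfies $$\langle e^{F(g(u))}F'(g(u))-e^{F(g(v))}F'(g(v)),\,g(u)-g(v)\rangle\ge 2\mu\,\|g(v)-g(u)\|^2\qquad\text{for all } g(u),g(v)\in K_g ,$$ then $$e^{F(g(v))}-e^{F(g(u))}\ge\langle e^{F(g(u))}F'(g(u)),\,g(v)-g(u)\rangle+\mu\,\|g(v)-g(u)\|^2\qquad\text{for all } g(u),g(v)\in K_g .$$
   Context: $H$ is a real Hilbert space with inner product $\langle\cdot,\cdot\rangle$ and norm $\|\cdot\|$, and $g:H\to H$ is an arbitrary function. $K_g\subseteq H$ is a general convex set with respect to $g$: $g(u)+t(g(v)-g(u))\in K_g$ for all $u,v\in H$ with $g(u),g(v)\in K_g$ and all $t\in[0,1]$. As a standing assumption $g$ is onto $K_g$ (every point of $K_g$ is $g(v)$ for some $v\in H$). "For all $g(u),g(v)\in K_g$" means for all $u,v\in H$ with $g(u),g(v)\in K_g$. A positive real-valued function $F$ on $K_g$ is strongly exponentially general convex if there is a constant $c>0$ such that $$e^{F(g(u)+t(g(v)-g(u)))}\le(1-t)e^{F(g(u))}+te^{F(g(v))}-c\,t(1-t)\,\|g(v)-g(u)\|^2$$ for all $g(u),g(v)\in K_g$ and $t\in[0,1]$. "Differentiable" means Fréchet differentiable at the points of $K_g$ ($F$ being understood as defined near $K_g$), with $F'$ identified with an element of $H$. *)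

theory Defs
  imports "HOL-Analysis.Analysis"
begin

definition general_convex_set :: "('a::real_vector \<Rightarrow> 'a) \<Rightarrow> 'a set \<Rightarrow> bool" where
  "general_convex_set g K \<longleftrightarrow>
     (\<forall>u v. g u \<in> K \<longrightarrow> g v \<in> K \<longrightarrow>
        (\<forall>t\<in>{0..1::real}. g u + t *\<^sub>R (g v - g u) \<in> K))"

text \<open>A function on \<open>K\<close> is a total function of which only the values on \<open>K\<close> are
  constrained; in particular positivity is required on \<open>K\<close> only.\<close>

definition strongly_exp_general_convex ::
    "('a::real_inner \<Rightarrow> 'a) \<Rightarrow> 'a set \<Rightarrow> ('a \<Rightarrow> real) \<Rightarrow> bool" where
  "strongly_exp_general_convex g K F \<longleftrightarrow>
     (\<forall>x\<in>K. F x > 0) \<and>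
     (\<exists>c>0. \<forall>u v. g u \<in> K \<longrightarrow> g v \<in> K \<longrightarrow>
        (\<forall>t\<in>{0..1}.
           exp (F (g u + t *\<^sub>R (g v - g u)))
             \<le> (1 - t) * exp (F (g u)) + t * exp (F (g v))
               - c * t * (1 - t) * (norm (g v - g u))\<^sup>2))"

end

theory Submission
  imports Defs
begin

text \<open>
  Restrict \<open>exp \<circ> F\<close>, with gradient \<open>G = exp F \<cdot> F'\<close>, to a segment from
  \<open>x\<close> to \<open>y\<close>. Comparing \<open>G\<close> at \<open>x + t (y - x)\<close> with \<open>G\<close> at \<open>x\<close>, the
  monotonicity hypothesis carries a factor \<open>t\<close> on the left and \<open>t\<^sup>2\<close> on the right;
  cancelling one \<open>t\<close> shows that the slope along the segment exceeds its initial
  value by at least \<open>2 \<mu> t \<parallel>y - x\<parallel>\<^sup>2\<close>. Integrating this over \<open>[0, 1]\<close> gives the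
  linear term plus \<open>\<mu> \<parallel>y - x\<parallel>\<^sup>2\<close>. The integration takes differential form: the
  difference between the restricted function and the desired quadratic minorant
  has a nonnegative derivative in \<open>t\<close>, hence is nondecreasing on \<open>[0, 1]\<close>.

  This is the content of \<open>quadratic_growth_if_gradient_strongly_monotone_from\<close>, which
  knows nothing of \<open>g\<close>. It applies because the segment between two values of \<open>g\<close> in
  \<open>K\<close> stays in \<open>K\<close>, and each of its points is again a value of \<open>g\<close>.
\<close>

text \<open>
  The slope along the segment is only ever compared with the slope at its start, so
  the estimate concerns a single segment and monotonicity is required against the
  fixed endpoint \<open>x\<close> alone.
\<close>

lemma quadratic_growth_if_gradient_strongly_monotone_from:
  fixes f :: "'a::real_inner \<Rightarrow> real" and G :: "'a \<Rightarrow> 'a"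
  assumes grad: "\<And>z. z \<in> closed_segment x y \<Longrightarrow> GDERIV f z :> G z"
    and mono: "\<And>z. z \<in> closed_segment x y \<Longrightarrow>
                 inner (G z - G x) (z - x) \<ge> 2 * \<mu> * (norm (z - x))\<^sup>2"
  shows "f y - f x \<ge> inner (G x) (y - x) + \<mu> * (norm (y - x))\<^sup>2"
proof -
  define d where "d = y - x"
  define p where "p t = x + t *\<^sub>R d" for t :: real
  define \<phi> where
    "\<phi> t = f (p t) - t * inner (G x) d - \<mu> * t\<^sup>2 * (norm d)\<^sup>2" for t
  have p_in: "p t \<in> closed_segment x y" if "0 \<le> t" "t \<le> 1" for t
    using that unfolding p_def d_def in_segment
    by (auto intro!: exI[of _ t] simp: algebra_simps)
  have "\<phi> 0 \<le> \<phi> 1"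
  proof (rule DERIV_nonneg_imp_nondecreasing[of 0 1 \<phi>])
    fix t :: real
    assume t: "0 \<le> t" "t \<le> 1"
    let ?D = "inner (G (p t)) d - inner (G x) d - 2 * \<mu> * t * (norm d)\<^sup>2"
    have "(p has_derivative (\<lambda>h. h *\<^sub>R d)) (at t)"
      unfolding p_def by (auto intro!: derivative_eq_intros)
    moreover have "(f has_derivative (\<lambda>h. inner h (G (p t)))) (at (p t))"
      using grad[OF p_in[OF t]] by (simp add: gderiv_def)
    ultimately have "((\<lambda>s. f (p s)) has_derivative (\<lambda>h. inner (h *\<^sub>R d) (G (p t)))) (at t)"
      by (rule has_derivative_compose)
    then have "((\<lambda>s. f (p s)) has_real_derivative inner (G (p t)) d) (at t)"
      by (simp add: has_field_derivative_def inner_commute mult_commute_abs)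
    then have "(\<phi> has_real_derivative ?D) (at t)"
      unfolding \<phi>_def by (auto intro!: derivative_eq_intros)
    moreover have "?D \<ge> 0"
    proof (cases "t = 0")
      case True
      then show ?thesis by (simp add: p_def)
    next
      case False
      have "2 * \<mu> * (t\<^sup>2 * (norm d)\<^sup>2) \<le> t * inner (G (p t) - G x) d"
        using mono[OF p_in[OF t]] by (simp add: p_def power_mult_distrib)
      then have "t * ?D \<ge> 0"
        by (simp add: inner_diff_left algebra_simps power2_eq_square)
      then show ?thesis
        using False t by (simp add: zero_le_mult_iff)
    qed
    ultimately show "\<exists>l. (\<phi> has_real_derivative l) (at t) \<and> l \<ge> 0"
      by blast
  qed simp
  then show ?thesis
    by (simp add: \<phi>_def p_def d_def)
qed

lemma general_convex_set_closed_segment_subset: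
  assumes "general_convex_set g K" "g u \<in> K" "g v \<in> K"
  shows "closed_segment (g u) (g v) \<subseteq> K"
proof
  fix z
  assume "z \<in> closed_segment (g u) (g v)"
  then obtain t where "0 \<le> t" "t \<le> 1" "z = g u + t *\<^sub>R (g v - g u)"
    by (auto simp: in_segment algebra_simps)
  then show "z \<in> K"
    using assms by (auto simp: general_convex_set_def)
qed

theorem theorem31:
  fixes g :: "'a::{real_inner, complete_space} \<Rightarrow> 'a"
    and K :: "'a set"
    and F :: "'a \<Rightarrow> real"
    and F' :: "'a \<Rightarrow> 'a"
    and \<mu> :: real
  assumes "K \<subseteq> range g"
    and "general_convex_set g K"
    and "\<mu> > 0"
    and "strongly_exp_general_convex g K F"
    and "\<forall>x\<in>K. GDERIV F x :> F' x"
    and "\<forall>u v. g u \<in> K \<longrightarrow> g v \<in> K \<longrightarrow>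
           inner (exp (F (g u)) *\<^sub>R F' (g u) - exp (F (g v)) *\<^sub>R F' (g v)) (g u - g v)
             \<ge> 2 * \<mu> * (norm (g v - g u))\<^sup>2"
  shows "\<forall>u v. g u \<in> K \<longrightarrow> g v \<in> K \<longrightarrow>
           exp (F (g v)) - exp (F (g u))
             \<ge> inner (exp (F (g u)) *\<^sub>R F' (g u)) (g v - g u)
               + \<mu> * (norm (g v - g u))\<^sup>2"
proof (intro allI impI)
  fix u v
  assume uv: "g u \<in> K" "g v \<in> K"
  define G where "G x = exp (F x) *\<^sub>R F' x" for x
  have seg: "closed_segment (g u) (g v) \<subseteq> K"
    using assms(2) uv by (rule general_convex_set_closed_segment_subset)
  have "exp (F (g v)) - exp (F (g u))
          \<ge> inner (G (g u)) (g v - g u) + \<mu> * (norm (g v - g u))\<^sup>2"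
  proof (rule quadratic_growth_if_gradient_strongly_monotone_from)
    fix z
    assume "z \<in> closed_segment (g u) (g v)"
    with seg have z: "z \<in> K" by blast
    then show "GDERIV (\<lambda>x. exp (F x)) z :> G z"
      unfolding G_def using assms(5) by (intro GDERIV_DERIV_compose DERIV_exp) blast
    \<comment> \<open>Monotonicity is only assumed at values of \<open>g\<close>; since \<open>g\<close> is onto \<open>K\<close>, the
      intermediate point \<open>z\<close> is such a value.\<close>
    from z assms(1) obtain w where "z = g w" by blast
    then show "inner (G z - G (g u)) (z - g u) \<ge> 2 * \<mu> * (norm (z - g u))\<^sup>2"
      using assms(6) z uv(1) by (simp add: G_def norm_minus_commute[of "g w"])
  qed
  then show "exp (F (g v)) - exp (F (g u))
      \<ge> inner (exp (F (g u)) *\<^sub>R F' (g u)) (g v - g u) + \<mu> * (norm (g v - g u))\<^sup>2"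
    by (simp add: G_def)
qed

end
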